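(* There is a bounded function $e_9$ on the positive integers such that $M(9, n) = \lfloor n/17\rfloor + e_9(n)$ for all positive integers $n$; equivalently, $M(9,n)-\lfloor n/17\rfloor$ is bounded as $n$ ranges over the positive integers.
   Context: The $T$-tetromino is the polyomino formed by four unit squares: three in a row together with a fourth square attached to the middle square of that row. A tiling of an $m\times n$ rectangle (of unit cells) by $T$-tetrominos and monominos is a partition of its cells into copies of the $T$-tetromino (in any rotation or reflection, aligned with the grid) and single cells (monominos). The gap number $M(m,n)$ is the least number of monominos occurring in such a tiling of the $m\times n$ rectangle. *)

theory Defs
  imports Complex_Main "HOL-Library.Disjoint_Sets"
begin

text \<open>A unit cell of the square grid is represented by its integer coordinates.\<close>

type_synonym cell = "int \<times> int"

definition rectangle :: "nat \<Rightarrow> nat \<Rightarrow> cell set" where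
  "rectangle m n = {0..<int m} \<times> {0..<int n}"

text \<open>The symmetries of the grid: a translation composed with one of the eight rotations and
  reflections fixing the origin.\<close>

definition grid_isometries :: "(cell \<Rightarrow> cell) set" where
  "grid_isometries =
     {f. \<exists>a b s t. s \<in> {1, -1} \<and> t \<in> {1, -1} \<and>
        (f = (\<lambda>(x, y). (a + s * x, b + t * y)) \<or> f = (\<lambda>(x, y). (a + s * y, b + t * x)))}"

definition T_tetromino :: "cell set" where
  "T_tetromino = {(0, 0), (1, 0), (2, 0), (1, 1)}"

definition is_T_tetromino :: "cell set \<Rightarrow> bool" where
  "is_T_tetromino t \<longleftrightarrow> (\<exists>f \<in> grid_isometries. t = f ` T_tetromino)"

definition is_monomino :: "cell set \<Rightarrow> bool" where
  "is_monomino t \<longleftrightarrow> (\<exists>c. t = {c})"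

definition is_tiling :: "nat \<Rightarrow> nat \<Rightarrow> cell set set \<Rightarrow> bool" where
  "is_tiling m n P \<longleftrightarrow>
     partition_on (rectangle m n) P \<and> (\<forall>t \<in> P. is_T_tetromino t \<or> is_monomino t)"

definition num_monominos :: "cell set set \<Rightarrow> nat" where
  "num_monominos P = card {t \<in> P. is_monomino t}"

definition gap_number :: "nat \<Rightarrow> nat \<Rightarrow> nat" where
  "gap_number m n = (LEAST k. \<exists>P. is_tiling m n P \<and> num_monominos P = k)"

text \<open>A tiling always exists and has finitely many tiles, so the minimum and the cardinality
  above are genuine.\<close>

lemma is_tiling_singletons: "is_tiling m n ((\<lambda>c. {c}) ` rectangle m n)"
  by (auto simp: is_tiling_def is_monomino_def partition_on_def disjoint_def)

lemma is_tiling_finite: "is_tiling m n P \<Longrightarrow> finite P"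
  by (rule finite_elements[of "rectangle m n"]) (auto simp: is_tiling_def rectangle_def)

lemma gap_number_attained: "\<exists>P. is_tiling m n P \<and> num_monominos P = gap_number m n"
  unfolding gap_number_def
  by (rule LeastI_ex) (use is_tiling_singletons in blast)

end

theory Submission
  imports Defs
begin

text \<open>For the upper bound, the infinite strip of width 9 has a tiling of period 17 with one monomino
  per period; cutting it to \<open>n\<close> columns costs a bounded number of further monominos.

  For the lower bound, any 17 consecutive columns after the first column of a tiling contain a
  monomino. Otherwise these columns and the one before them would be covered by T-tetrominoes, parts of
  T-tetrominoes entering from the left, and single cells of that preceding column. Always covering the
  first free cell in column order, one sees in a finite search that this is impossible.\<close>

section \<open>Periodic packings\<close>

text \<open>The first coordinate of a cell is its row, the second its column. The three cells in line start
  at \<open>(x, y)\<close> and lie in row \<open>x\<close> if \<open>h\<close> holds, in column \<open>y\<close> otherwise; \<open>s = 1\<close> or \<open>s = -1\<close> is the side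
  of the fourth cell.\<close>

fun T_cells :: "bool \<times> int \<times> int \<times> int \<Rightarrow> cell list" where
  "T_cells (h, x, y, s) =
     (if h then [(x, y), (x, y + 1), (x, y + 2), (x + s, y + 1)]
      else [(x, y), (x + 1, y), (x + 2, y), (x + 1, y + s)])"

lemma is_T_tetromino_T_cells:
  assumes "s \<in> {1, -1}"
  shows "is_T_tetromino (set (T_cells (h, x, y, s)))"
proof (cases h)
  case True
  have "(\<lambda>(x', y'). (x + s * y', y + 1 * x')) \<in> grid_isometries"
    using assms unfolding grid_isometries_def by blast
  moreover have "set (T_cells (h, x, y, s)) = (\<lambda>(x', y'). (x + s * y', y + 1 * x')) ` T_tetromino"
    using True by (auto simp: T_tetromino_def)
  ultimately show ?thesis unfolding is_T_tetromino_def by blast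
next
  case False
  have "(\<lambda>(x', y'). (x + 1 * x', y + s * y')) \<in> grid_isometries"
    using assms unfolding grid_isometries_def by blast
  moreover have "set (T_cells (h, x, y, s)) = (\<lambda>(x', y'). (x + 1 * x', y + s * y')) ` T_tetromino"
    using False by (auto simp: T_tetromino_def)
  ultimately show ?thesis unfolding is_T_tetromino_def by blast
qed

lemma is_T_tetromino_cases:
  assumes "is_T_tetromino t"
  obtains h x y s where "s \<in> {1, -1}" "t = set (T_cells (h, x, y, s))"
proof -
  obtain a b s u where su: "s \<in> {1, -1}" "u \<in> {1, -1}"
    and "t = (\<lambda>(x, y). (a + s * x, b + u * y)) ` T_tetromino \<or>
         t = (\<lambda>(x, y). (a + s * y, b + u * x)) ` T_tetromino"
    using assms unfolding is_T_tetromino_def grid_isometries_def by blast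
  then consider (in_column) "t = (\<lambda>(x, y). (a + s * x, b + u * y)) ` T_tetromino"
    | (in_row) "t = (\<lambda>(x, y). (a + s * y, b + u * x)) ` T_tetromino"
    by blast
  then show ?thesis
  proof cases
    case in_column
    then have "t = set (T_cells (False, if s = 1 then a else a - 2, b, u))"
      using su by (auto simp: T_tetromino_def)
    with su show ?thesis using that by blast
  next
    case in_row
    then have "t = set (T_cells (True, a, if u = 1 then b else b - 2, s))"
      using su by (auto simp: T_tetromino_def)
    with su show ?thesis using that by blast
  qed
qed

lemma card_T_tetromino:
  assumes "is_T_tetromino t"
  shows "card t = 4"
  using assms by (rule is_T_tetromino_cases) (auto simp: card_insert_if)

lemma not_is_monomino_T_tetromino:
  assumes "is_T_tetromino t"
  shows "\<not> is_monomino t"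
  using card_T_tetromino[OF assms] by (auto simp: is_monomino_def)

lemma gap_number_le_num_monominos: "is_tiling m n P \<Longrightarrow> gap_number m n \<le> num_monominos P"
  unfolding gap_number_def by (blast intro: Least_le)

lemma is_tiling_packing:
  assumes disj: "disjoint_family_on tile I"
    and T: "\<And>i. i \<in> I \<Longrightarrow> is_T_tetromino (tile i)"
    and sub: "\<And>i. i \<in> I \<Longrightarrow> tile i \<subseteq> rectangle m n"
  shows "is_tiling m n (tile ` I \<union> (\<lambda>c. {c}) ` (rectangle m n - (\<Union>i\<in>I. tile i)))"
    (is "is_tiling m n (?T \<union> ?M)")
proof -
  have "partition_on (rectangle m n) (?T \<union> ?M)"
  proof (rule partition_onI)
    show "\<Union>(?T \<union> ?M) = rectangle m n"
      using sub by auto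
    show "{} \<notin> ?T \<union> ?M"
      using T card_T_tetromino by fastforce
    show "disjnt p q" if "p \<in> ?T \<union> ?M" "q \<in> ?T \<union> ?M" "p \<noteq> q" for p q
      using that disjoint_family_on_disjoint_image[OF disj]
      unfolding disjoint_def disjnt_def by blast
  qed
  then show ?thesis
    using T by (auto simp: is_tiling_def is_monomino_def)
qed

lemma card_UN_T_tetrominoes:
  assumes "finite I" "disjoint_family_on tile I" "\<And>i. i \<in> I \<Longrightarrow> is_T_tetromino (tile i)"
  shows "card (\<Union>i\<in>I. tile i) = 4 * card I"
proof -
  have card4: "card (tile i) = 4" if "i \<in> I" for i
    using assms(3)[OF that] by (rule card_T_tetromino)
  then have "card (\<Union>i\<in>I. tile i) = (\<Sum>i\<in>I. card (tile i))"
    using assms(1,2) by (intro card_UN_disjoint') (auto intro: card_ge_0_finite)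
  then show ?thesis using card4 by simp
qed

lemma gap_number_le_packing:
  assumes "finite I" and disj: "disjoint_family_on tile I"
    and T: "\<And>i. i \<in> I \<Longrightarrow> is_T_tetromino (tile i)"
    and sub: "\<And>i. i \<in> I \<Longrightarrow> tile i \<subseteq> rectangle m n"
  shows "gap_number m n + 4 * card I \<le> m * n"
proof -
  define U where "U = (\<Union>i\<in>I. tile i)"
  define gaps where "gaps = (\<lambda>c. {c}) ` (rectangle m n - U)"
  have U: "U \<subseteq> rectangle m n" "card U = 4 * card I"
    using sub card_UN_T_tetrominoes[OF \<open>finite I\<close> disj T] by (auto simp: U_def)
  have R: "finite (rectangle m n)" "card (rectangle m n) = m * n"
    by (simp_all add: rectangle_def)
  have "gap_number m n \<le> num_monominos (tile ` I \<union> gaps)"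
    unfolding U_def gaps_def using disj T sub
    by (intro gap_number_le_num_monominos is_tiling_packing)
  also have "{t \<in> tile ` I \<union> gaps. is_monomino t} = gaps"
    using T not_is_monomino_T_tetromino by (fastforce simp: gaps_def is_monomino_def)
  then have "num_monominos (tile ` I \<union> gaps) = card (rectangle m n - U)"
    by (simp add: num_monominos_def gaps_def card_image)
  also have "\<dots> = m * n - 4 * card I"
    using U R finite_subset[OF U(1)] by (simp add: card_Diff_subset)
  finally show ?thesis
    using card_mono[OF R(1) U(1)] U(2) R(2) by linarith
qed

definition shift_columns :: "int \<Rightarrow> cell set \<Rightarrow> cell set" where
  "shift_columns d t = (\<lambda>(x, y). (x, y + d)) ` t"

lemma mem_shift_columns: "(x, y) \<in> shift_columns d t \<longleftrightarrow> (x, y - d) \<in> t"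
  by (force simp: shift_columns_def)

lemma is_T_tetromino_shift_columns:
  assumes "is_T_tetromino t"
  shows "is_T_tetromino (shift_columns d t)"
proof -
  obtain f where f: "f \<in> grid_isometries" "t = f ` T_tetromino"
    using assms unfolding is_T_tetromino_def by blast
  then obtain a b s u where "s \<in> {1, -1}" "u \<in> {1, -1}"
    and "f = (\<lambda>(x, y). (a + s * x, b + u * y)) \<or> f = (\<lambda>(x, y). (a + s * y, b + u * x))"
    unfolding grid_isometries_def by blast
  then have "(\<lambda>(x, y). (x, y + d)) \<circ> f \<in> grid_isometries"
    unfolding grid_isometries_def
    by (intro CollectI exI[of _ a] exI[of _ "b + d"] exI[of _ s] exI[of _ u]) auto
  with f(2) show ?thesis
    unfolding is_T_tetromino_def shift_columns_def by (metis image_comp)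
qed

lemma disjoint_family_on_shift_columns:
  assumes "p > 0" and inj: "inj_on (\<lambda>(i, x, y). (x, y mod int p)) (SIGMA i:I. tile i)"
  shows "disjoint_family_on (\<lambda>(j, i). shift_columns (int (p * j)) (tile i)) (J \<times> I)"
proof -
  have "j = j' \<and> i = i'"
    if "i \<in> I" "i' \<in> I" "(x, y - int (p * j)) \<in> tile i" "(x, y - int (p * j')) \<in> tile i'"
    for j j' i i' x y
  proof -
    have "(y - int (p * j)) mod int p = (y - int (p * j')) mod int p"
      by (simp add: mod_diff_eq flip: mod_diff_right_eq)
    then have "(i, x, y - int (p * j)) = (i', x, y - int (p * j'))"
      using that by (intro inj_onD[OF inj]) auto
    with \<open>p > 0\<close> show ?thesis by simp
  qed
  then show ?thesis
    by (fastforce simp: disjoint_family_on_def mem_shift_columns)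
qed

lemma gap_number_le_periodic_packing:
  assumes fin: "finite I" and "p > 0"
    and T: "\<And>i. i \<in> I \<Longrightarrow> is_T_tetromino (tile i)"
    and sub: "\<And>i. i \<in> I \<Longrightarrow> tile i \<subseteq> rectangle m w"
    and inj: "inj_on (\<lambda>(i, x, y). (x, y mod int p)) (SIGMA i:I. tile i)"
    and fit: "\<And>j. j < k \<Longrightarrow> p * j + w \<le> n"
  shows "gap_number m n + 4 * (k * card I) \<le> m * n"
proof -
  define copy where "copy = (\<lambda>(j, i). shift_columns (int (p * j)) (tile i))"
  have "gap_number m n + 4 * card ({..<k} \<times> I) \<le> m * n"
  proof (rule gap_number_le_packing)
    show "finite ({..<k} \<times> I)" using fin by simp
    show "disjoint_family_on copy ({..<k} \<times> I)"
      unfolding copy_def using \<open>p > 0\<close> inj by (rule disjoint_family_on_shift_columns)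
    fix a assume "a \<in> {..<k} \<times> I"
    then obtain j i where a: "a = (j, i)" "j < k" "i \<in> I" by auto
    show "is_T_tetromino (copy a)"
      using a T by (auto simp: copy_def intro: is_T_tetromino_shift_columns)
    show "copy a \<subseteq> rectangle m n"
    proof (rule subrelI)
      fix x y assume xy: "(x, y) \<in> copy a"
      define d where "d = int (p * j)"
      have "(x, y - d) \<in> rectangle m w"
        using xy a sub by (auto simp: copy_def d_def mem_shift_columns)
      moreover have "0 \<le> d" "d + int w \<le> int n"
        using fit[OF a(2)] by (auto simp: d_def simp flip: of_nat_add of_nat_mult)
      ultimately show "(x, y) \<in> rectangle m n" by (auto simp: rectangle_def)
    qed
  qed
  then show ?thesis by (simp add: card_cartesian_product)
qed

text \<open>In every period of 17 columns, the translates of these tiles by multiples of 17 columns leave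
  free only the cell \<open>(4, 0)\<close>.\<close>

definition pattern :: "(bool \<times> int \<times> int \<times> int) list" where
  "pattern =
    [(True, 1, 0, -1), (False, 2, 1, -1), (True, 6, 0, -1), (True, 8, 0, -1),
     (True, 0, 2, 1), (False, 2, 2, 1), (True, 5, 2, -1), (False, 6, 3, -1),
     (False, 1, 4, -1), (True, 4, 4, 1), (False, 6, 4, 1), (True, 0, 5, 1),
     (False, 1, 5, 1), (True, 6, 5, -1), (True, 8, 5, -1), (False, 2, 7, -1),
     (False, 0, 8, -1), (True, 5, 7, -1), (False, 6, 8, -1), (True, 3, 8, 1),
     (False, 0, 9, 1), (False, 6, 9, 1), (True, 0, 10, 1), (True, 2, 10, 1),
     (False, 4, 10, 1), (True, 8, 10, -1), (True, 4, 11, -1), (False, 5, 12, -1),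
     (False, 0, 13, -1), (True, 3, 13, 1), (False, 5, 13, 1), (True, 8, 13, -1),
     (False, 0, 14, 1), (False, 4, 15, -1), (True, 0, 15, 1), (True, 2, 15, 1),
     (True, 7, 15, 1), (False, 4, 16, 1)]"

lemma pattern_tiles:
  assumes "p \<in> set pattern"
  shows "is_T_tetromino (set (T_cells p))" and "set (T_cells p) \<subseteq> rectangle 9 19"
proof -
  have "\<forall>(h, x, y, s) \<in> set pattern. s \<in> {1, -1} \<and> set (T_cells (h, x, y, s)) \<subseteq> rectangle 9 19"
    by (simp add: pattern_def rectangle_def)
  with assms show "is_T_tetromino (set (T_cells p))" and "set (T_cells p) \<subseteq> rectangle 9 19"
    using is_T_tetromino_T_cells by (cases p; fastforce)+
qed

lemma card_pattern: "card (set pattern) = 38"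
proof -
  have "distinct pattern" by (simp add: pattern_def)
  moreover have "length pattern = 38" by (simp add: pattern_def)
  ultimately show ?thesis by (simp add: distinct_card)
qed

lemma inj_on_pattern_residues:
  "inj_on (\<lambda>(p, x, y). (x, y mod int 17)) (SIGMA p:set pattern. set (T_cells p))"
proof -
  define cells where "cells = concat (map (\<lambda>p. map (Pair p) (T_cells p)) pattern)"
  have "distinct (map (\<lambda>(p, x, y). (x, y mod int 17)) cells)"
    by (simp add: cells_def pattern_def)
  moreover have "(SIGMA p:set pattern. set (T_cells p)) = set cells"
    by (auto simp: cells_def)
  ultimately show ?thesis by (simp add: distinct_map)
qed

lemma gap_number_9_le: "gap_number 9 n \<le> n div 17 + 162"
proof -
  define k where "k = (n - 2) div 17"
  have k: "17 * k \<le> n - 2" "n < 17 * k + 19" "k \<le> n div 17"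
    unfolding k_def by (linarith, linarith, simp add: div_le_mono)
  have "gap_number 9 n + 4 * (k * card (set pattern)) \<le> 9 * n"
    using pattern_tiles inj_on_pattern_residues
    by (rule gap_number_le_periodic_packing[where p = 17 and w = 19, rotated 2]) (use k in auto)
  with k show ?thesis by (simp add: card_pattern)
qed

section \<open>Sequential filling\<close>

text \<open>An initial segment of the natural numbers is covered from left to right by disjoint pieces. All
  sets are relative to the current number: \<open>S\<close> is what earlier pieces already cover from there on, and
  the members of \<open>Ds\<close> are the possible pieces starting there.\<close>

fun fillable :: "nat set set list \<Rightarrow> nat set \<Rightarrow> bool" where
  "fillable [] S \<longleftrightarrow> True"
| "fillable (Ds # Dss) S \<longleftrightarrow>
     (if 0 \<in> S then fillable Dss (Suc -` S)
      else \<exists>D\<in>Ds. D \<inter> S = {} \<and> fillable Dss (Suc -` (D \<union> S)))"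

definition offered :: "nat set set list \<Rightarrow> nat set \<Rightarrow> bool" where
  "offered Dss q \<longleftrightarrow> (\<exists>k D. q = (+) k ` D \<and> 0 \<in> D \<and> (k < length Dss \<longrightarrow> D \<in> Dss ! k))"

definition overhang :: "nat set set \<Rightarrow> nat \<Rightarrow> nat set" where
  "overhang Q k = {i. \<exists>q\<in>Q. k + i \<in> q \<and> (\<exists>j\<in>q. j < k)}"

lemma overhang_Suc: "overhang Q (Suc k) = Suc -` ({i. \<exists>q\<in>Q. k \<in> q \<and> k + i \<in> q} \<union> overhang Q k)"
  by (auto simp: overhang_def less_Suc_eq)

lemma overhang_Suc_covered:
  assumes "disjoint Q" "0 \<in> overhang Q k"
  shows "overhang Q (Suc k) = Suc -` overhang Q k"
proof -
  obtain q j where q: "q \<in> Q" "k \<in> q" "j \<in> q" "j < k"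
    using assms(2) by (auto simp: overhang_def)
  then have "r = q" if "r \<in> Q" "k \<in> r" for r
    using disjointD[OF assms(1) that(1) q(1)] that(2) by blast
  then have "{i. \<exists>q\<in>Q. k \<in> q \<and> k + i \<in> q} \<subseteq> overhang Q k"
    unfolding overhang_def using q by blast
  then show ?thesis by (simp only: overhang_Suc Un_absorb1)
qed

lemma overhang_Suc_uncovered:
  assumes "k \<notin> \<Union>Q"
  shows "overhang Q (Suc k) = Suc -` overhang Q k"
  using assms by (auto simp: overhang_Suc)

lemma overhang_Suc_piece:
  assumes disj: "disjoint Q" and "(+) k ` D \<in> Q" "0 \<in> D"
  shows "D \<inter> overhang Q k = {}" and "overhang Q (Suc k) = Suc -` (D \<union> overhang Q k)"
proof -
  have unique: "q = (+) k ` D" if "q \<in> Q" "i \<in> D" "k + i \<in> q" for q i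
    using disjointD[OF disj that(1) assms(2)] that(2,3) by (metis IntI empty_iff imageI)
  show "D \<inter> overhang Q k = {}"
  proof (rule equals0I)
    fix i assume i: "i \<in> D \<inter> overhang Q k"
    then obtain q j where q: "q \<in> Q" "k + i \<in> q" "j \<in> q" "j < k"
      by (auto simp: overhang_def)
    with i have "q = (+) k ` D" by (intro unique) simp_all
    with q(3,4) show False by auto
  qed
  have "k \<in> (+) k ` D" using assms(3) by (rule image_eqI[rotated]) simp
  then have "(\<exists>q\<in>Q. k \<in> q \<and> k + i \<in> q) \<longleftrightarrow> k + i \<in> (+) k ` D" for i
    using assms(2) unique[OF _ assms(3)] by (metis add.right_neutral)
  then have "{i. \<exists>q\<in>Q. k \<in> q \<and> k + i \<in> q} = D" by auto
  then show "overhang Q (Suc k) = Suc -` (D \<union> overhang Q k)"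
    by (simp only: overhang_Suc)
qed

lemma fillable_if_disjoint_offered:
  assumes disj: "disjoint Q" and offered: "\<And>q. q \<in> Q \<Longrightarrow> offered Dss q"
    and cover: "\<And>k. k < length Dss \<Longrightarrow> {0} \<notin> Dss ! k \<Longrightarrow> k \<in> \<Union>Q"
  shows "fillable Dss {}"
proof -
  have "fillable (drop k Dss) (overhang Q k)" if "k \<le> length Dss" for k
    using that
  proof (induction k rule: inc_induct)
    case base
    then show ?case by simp
  next
    case (step k)
    have drop: "drop k Dss = Dss ! k # drop (Suc k) Dss"
      using step.hyps(2) by (simp add: Cons_nth_drop_Suc)
    consider (covered) "0 \<in> overhang Q k" | (uncovered) "0 \<notin> overhang Q k" "k \<notin> \<Union>Q"
      | (first) q where "0 \<notin> overhang Q k" "q \<in> Q" "k \<in> q" by blast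
    then show ?case
    proof cases
      case covered
      with step.IH show ?thesis by (simp add: drop overhang_Suc_covered[OF disj])
    next
      case uncovered
      then have "{0} \<in> Dss ! k" using cover step.hyps(2) by blast
      moreover have "Suc -` {0} = {}" by auto
      ultimately show ?thesis
        using uncovered(1) step.IH
        by (auto simp: drop overhang_Suc_uncovered[OF uncovered(2)] intro!: bexI[of _ "{0}"])
    next
      case first
      obtain l D where D: "q = (+) l ` D" "0 \<in> D" "l < length Dss \<longrightarrow> D \<in> Dss ! l"
        using offered[OF first(2)] unfolding offered_def by blast
      have "\<not> l < k" using first D(1,2) by (force simp: overhang_def)
      then have "l = k" using first(3) D(1) by auto
      have "(+) k ` D \<in> Q" using first(2) D(1) \<open>l = k\<close> by simp
      note piece = overhang_Suc_piece[OF disj this D(2)]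
      show ?thesis
        using first(1) D(3) step piece \<open>l = k\<close> by (auto simp: drop)
    qed
  qed
  from this[of 0] show ?thesis by (simp add: overhang_def)
qed

section \<open>Windows without monominos\<close>

text \<open>Cells of a strip of \<open>m\<close> rows are numbered column by column, starting with the first cell of
  column \<open>b\<close>. The offsets below are those of the cells of a T-tetromino whose least cell lies in row
  \<open>x\<close>.\<close>

definition T_offsets :: "nat \<Rightarrow> nat \<Rightarrow> nat set set" where
  "T_offsets m x =
     (if x + 1 < m then {{0, m, m + 1, 2 * m}} else {}) \<union>
     (if 0 < x then {{0, m - 1, m, 2 * m}} else {}) \<union>
     (if x + 2 < m then {{0, 1, 2, m + 1}} else {}) \<union>
     (if 0 < x \<and> x + 1 < m then {{0, m - 1, m, m + 1}} else {})"

text \<open>In column \<open>b\<close> any cell may be left to a tile starting further left; \<open>{0, 1, m}\<close> and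
  \<open>{0, 1, m + 1}\<close> are what remains of a tile reaching column \<open>b + 1\<close> from there. The tetromino
  \<open>{0, 1, 2, m + 1}\<close> is redundant, being composed of \<open>{0, 1, m + 1}\<close> and a single cell.\<close>

definition entry_offsets :: "nat \<Rightarrow> nat \<Rightarrow> nat set set" where
  "entry_offsets m x =
     {{0}} \<union>
     (if x + 1 < m then {{0, 1, m}, {0, 1, m + 1}, {0, m, m + 1, 2 * m}} else {}) \<union>
     (if 0 < x then {{0, m - 1, m, 2 * m}} else {}) \<union>
     (if 0 < x \<and> x + 1 < m then {{0, m - 1, m, m + 1}} else {})"

definition window_offsets :: "nat \<Rightarrow> nat \<Rightarrow> nat set set list" where
  "window_offsets m L =
     map (entry_offsets m) [0..<m] @ concat (replicate L (map (T_offsets m) [0..<m]))"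

lemma zero_in_T_offsets: "D \<in> T_offsets m x \<Longrightarrow> 0 \<in> D"
  by (auto simp: T_offsets_def split: if_splits)

lemma zero_in_entry_offsets: "D \<in> entry_offsets m x \<Longrightarrow> 0 \<in> D"
  by (auto simp: entry_offsets_def split: if_splits)

lemma T_offsets_Diff_entry_offsets:
  "T_offsets m x - entry_offsets m x \<subseteq> (if x + 2 < m then {{0, 1, 2, m + 1}} else {})"
  by (auto simp: T_offsets_def entry_offsets_def)

lemma length_window_offsets: "length (window_offsets m L) = m * (L + 1)"
  by (simp add: window_offsets_def length_concat sum_list_replicate)

lemma nth_concat_replicate:
  assumes "i < length xs" "j < n"
  shows "concat (replicate n xs) ! (length xs * j + i) = xs ! i"
  using assms
proof (induction n arbitrary: j)
  case (Suc n)
  then show ?case by (cases j) (simp_all add: nth_append)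
qed simp

lemma nth_window_offsets:
  assumes "x < m" "c \<le> L"
  shows "window_offsets m L ! (m * c + x) = (if c = 0 then entry_offsets m x else T_offsets m x)"
proof (cases c)
  case 0
  with assms show ?thesis by (simp add: window_offsets_def nth_append)
next
  case (Suc d)
  have "concat (replicate L (map (T_offsets m) [0..<m])) ! (m * d + x) = T_offsets m x"
    using nth_concat_replicate[of x "map (T_offsets m) [0..<m]" d L] assms Suc by simp
  with assms Suc show ?thesis by (simp add: window_offsets_def nth_append add.assoc)
qed

lemma offered_window_offsets:
  assumes "x < m" "0 \<in> D" "c \<le> L \<Longrightarrow> D \<in> (if c = 0 then entry_offsets m x else T_offsets m x)"
  shows "offered (window_offsets m L) ((+) (m * c + x) ` D)"
proof -
  have "D \<in> window_offsets m L ! (m * c + x)" if "m * c + x < m * (L + 1)"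
  proof -
    have "m * c < m * (L + 1)" using that by linarith
    then have "c \<le> L" by (simp only: mult_less_cancel1) simp
    with assms show ?thesis by (simp add: nth_window_offsets)
  qed
  with assms(2) show ?thesis unfolding offered_def length_window_offsets by blast
qed

definition has_offered_part :: "nat \<Rightarrow> nat \<Rightarrow> nat set \<Rightarrow> bool" where
  "has_offered_part m L A \<longleftrightarrow>
     (\<exists>q\<subseteq>A. A - {..<m} \<subseteq> q \<and> (q = {} \<or> offered (window_offsets m L) q))"

lemma has_offered_part_if_offered: "offered (window_offsets m L) A \<Longrightarrow> has_offered_part m L A"
  unfolding has_offered_part_def by blast

lemma has_offered_part_column: "A \<subseteq> {..<m} \<Longrightarrow> has_offered_part m L A"
  unfolding has_offered_part_def by (intro exI[of _ "{}"]) blast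

lemma has_offered_part_entry:
  assumes "x < m" "D \<in> entry_offsets m x"
  shows "has_offered_part m L ((+) x ` D)"
  using offered_window_offsets[of x m D 0 L] assms zero_in_entry_offsets
  by (intro has_offered_part_if_offered) simp

lemma has_offered_part_T:
  assumes "x < m" "D \<in> T_offsets m x"
  shows "has_offered_part m L ((+) (m * c + x) ` D)"
proof (cases "c = 0 \<and> D \<notin> entry_offsets m x")
  case True
  then have D: "x + 2 < m" "D = {0, 1, 2, m + 1}"
    using assms T_offsets_Diff_entry_offsets[of m x] by (auto split: if_splits)
  then have "offered (window_offsets m L) ((+) x ` {0, 1, m + 1})"
    using offered_window_offsets[of x m "{0, 1, m + 1}" 0 L] by (simp add: entry_offsets_def)
  then show ?thesis
    unfolding has_offered_part_def using True D by (intro exI[of _ "(+) x ` {0, 1, m + 1}"]) auto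
next
  case False
  then show ?thesis
    using assms zero_in_T_offsets by (intro has_offered_part_if_offered offered_window_offsets) auto
qed

fun cell_index :: "nat \<Rightarrow> int \<Rightarrow> cell \<Rightarrow> nat" where
  "cell_index m b (x, y) = m * nat (y - b) + nat x"

lemma inj_on_cell_index: "inj_on (cell_index m b) ({0..<int m} \<times> {b..})"
proof (rule inj_onI)
  fix c d assume *: "c \<in> {0..<int m} \<times> {b..}" "d \<in> {0..<int m} \<times> {b..}"
    and eq: "cell_index m b c = cell_index m b d"
  obtain x y x' y' where [simp]: "c = (x, y)" "d = (x', y')" by (cases c, cases d)
  have "nat x < m" "nat x' < m" using * by auto
  then have "nat (y - b) = nat (y' - b)" "nat x = nat x'"
    using arg_cong[OF eq, of "\<lambda>k. k div m"] arg_cong[OF eq, of "\<lambda>k. k mod m"] by simp_all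
  with * show "c = d" by auto
qed

definition trace :: "nat \<Rightarrow> int \<Rightarrow> cell set \<Rightarrow> nat set" where
  "trace m b t = cell_index m b ` {(x, y) \<in> t. b \<le> y}"

lemma trace_empty [simp]: "trace m b {} = {}"
  by (simp add: trace_def)

lemma trace_insert [simp]:
  "trace m b (insert (x, y) t) =
     (if b \<le> y then insert (m * nat (y - b) + nat x) (trace m b t) else trace m b t)"
  by (force simp: trace_def)

lemma trace_disjoint:
  assumes "t \<subseteq> {0..<int m} \<times> UNIV" "u \<subseteq> {0..<int m} \<times> UNIV" "t \<inter> u = {}"
  shows "trace m b t \<inter> trace m b u = {}"
proof -
  define right where "right s = {(x, y) \<in> s. b \<le> y}" for s :: "cell set"
  have "right t \<subseteq> {0..<int m} \<times> {b..}" "right u \<subseteq> {0..<int m} \<times> {b..}" "right t \<inter> right u = {}"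
    using assms by (auto simp: right_def)
  then show ?thesis
    using inj_on_image_Int[OF inj_on_cell_index[of m b], of "right t" "right u"]
    by (simp add: trace_def right_def)
qed

lemma has_offered_part_T_in_row:
  assumes "s \<in> {1, -1}" and strip: "set (T_cells (True, x, y, s)) \<subseteq> {0..<int m} \<times> UNIV"
  shows "has_offered_part m L (trace m b (set (T_cells (True, x, y, s))))" (is "_ (trace m b ?t)")
proof -
  have "0 \<le> x" using strip by simp
  then obtain a where a: "x = int a" by (rule nonneg_int_cases)
  have s: "s = 1 \<and> a + 1 < m \<or> s = -1 \<and> 0 < a \<and> a < m"
    using assms by (auto simp: a)
  consider (inside) "b \<le> y" | (entering) "y = b - 1" | (outside) "y < b - 1" by linarith
  then show ?thesis
  proof cases
    case inside
    then obtain c where c: "y = b + int c" using zle_iff_zadd by blast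
    define D where "D = (if s = 1 then {0, m, m + 1, 2 * m} else {0, m - 1, m, 2 * m})"
    have "trace m b ?t = (+) (m * c + a) ` D"
    proof (cases "s = 1")
      case True
      then show ?thesis
        by (simp add: a c D_def nat_add_distrib algebra_simps mult_2_right insert_commute)
    next
      case False
      with s show ?thesis
        by (cases a)
          (simp_all add: a c D_def nat_add_distrib algebra_simps mult_2_right insert_commute)
    qed
    moreover have "D \<in> T_offsets m a" using s by (auto simp: D_def T_offsets_def)
    ultimately show ?thesis using s has_offered_part_T[of a m D L c] by auto
  next
    case entering
    show ?thesis
    proof (cases "s = 1")
      case True
      then have "trace m b ?t = (+) a ` {0, 1, m}" by (auto simp: a entering)
      moreover have "{0, 1, m} \<in> entry_offsets m a" using True s by (simp add: entry_offsets_def)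
      ultimately show ?thesis using s has_offered_part_entry[of a m "{0, 1, m}" L] by auto
    next
      case False
      with s have "trace m b ?t = (+) (a - 1) ` {0, 1, m + 1}" by (auto simp: a entering)
      moreover have "{0, 1, m + 1} \<in> entry_offsets m (a - 1)"
        using False s by (auto simp: entry_offsets_def)
      ultimately show ?thesis
        using False s has_offered_part_entry[of "a - 1" m "{0, 1, m + 1}" L] by auto
    qed
  next
    case outside
    then show ?thesis using s by (intro has_offered_part_column) (auto simp: a)
  qed
qed

lemma has_offered_part_T_in_column:
  assumes "s \<in> {1, -1}" and strip: "set (T_cells (False, x, y, s)) \<subseteq> {0..<int m} \<times> UNIV"
  shows "has_offered_part m L (trace m b (set (T_cells (False, x, y, s))))" (is "_ (trace m b ?t)")
proof -
  have "0 \<le> x" using strip by simp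
  then obtain a where a: "x = int a" by (rule nonneg_int_cases)
  have m: "a + 2 < m" using strip by (simp add: a)
  consider (right) "s = 1" "b \<le> y" | (left) "s = -1" "b \<le> y - 1" | (outside) "y < b \<or> s = -1 \<and> y = b"
    using assms(1) by fastforce
  then show ?thesis
  proof cases
    case right
    then obtain c where c: "y = b + int c" using zle_iff_zadd by blast
    have "trace m b ?t = (+) (m * c + a) ` {0, 1, 2, m + 1}"
      using right by (simp add: a c nat_add_distrib algebra_simps insert_commute)
    then show ?thesis
      using m has_offered_part_T[of a m "{0, 1, 2, m + 1}" L c] by (simp add: T_offsets_def)
  next
    case left
    then obtain c where "y - 1 = b + int c" using zle_iff_zadd by blast
    then have c: "y = b + int c + 1" by simp
    have "trace m b ?t = (+) (m * c + (a + 1)) ` {0, m - 1, m, m + 1}"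
      using left m by (auto simp: a c nat_add_distrib algebra_simps)
    then show ?thesis
      using m has_offered_part_T[of "a + 1" m "{0, m - 1, m, m + 1}" L c]
      by (simp add: T_offsets_def)
  next
    case outside
    then show ?thesis using m assms(1) by (intro has_offered_part_column) (auto simp: a)
  qed
qed

lemma has_offered_part_trace:
  assumes "is_T_tetromino t \<or> is_monomino t" and strip: "t \<subseteq> {0..<int m} \<times> UNIV"
    and no_mono: "\<And>x y. t = {(x, y)} \<Longrightarrow> y \<le> b \<or> b + int L < y"
  shows "has_offered_part m L (trace m b t)"
  using assms(1)
proof
  assume "is_T_tetromino t"
  then obtain h x y s where s: "s \<in> {1, -1}" and t: "t = set (T_cells (h, x, y, s))"
    by (rule is_T_tetromino_cases)
  show ?thesis
    using has_offered_part_T_in_row[OF s] has_offered_part_T_in_column[OF s] strip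
    unfolding t by (metis (full_types))
next
  assume "is_monomino t"
  then obtain x y where t: "t = {(x, y)}" unfolding is_monomino_def by force
  show ?thesis
  proof (cases "y \<le> b")
    case True
    then show ?thesis using strip by (intro has_offered_part_column) (auto simp: t)
  next
    case False
    have "offered (window_offsets m L) ((+) (m * nat (y - b) + nat x) ` {0})"
      using False no_mono[OF t] strip by (intro offered_window_offsets) (auto simp: t)
    then show ?thesis
      using False by (intro has_offered_part_if_offered) (simp add: t)
  qed
qed

lemma index_in_trace:
  assumes "is_tiling m n P" "b + L < n" "k < m * (L + 1)"
  shows "\<exists>t\<in>P. k \<in> trace m (int b) t"
proof -
  have "m > 0" using assms(3) by (auto intro: gr0I)
  have "k div m < L + 1" using assms(3) by (intro less_mult_imp_div_less) (simp add: mult.commute)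
  define c :: cell where "c = (int (k mod m), int (b + k div m))"
  have "c \<in> rectangle m n"
    using \<open>m > 0\<close> \<open>k div m < L + 1\<close> \<open>b + L < n\<close> by (simp add: c_def rectangle_def)
  then obtain t where t: "t \<in> P" "c \<in> t"
    using assms(1) partition_onD1[of "rectangle m n" P] unfolding is_tiling_def by blast
  have "cell_index m (int b) c \<in> trace m (int b) t"
    unfolding trace_def using t(2) by (intro imageI) (simp add: c_def)
  moreover have "cell_index m (int b) c = k" by (simp add: c_def)
  ultimately show ?thesis using t(1) by blast
qed

lemma fillable_window_offsets:
  assumes tiling: "is_tiling m n P" and "b + L < n"
    and no_mono: "\<And>x y. {(x, y)} \<in> P \<Longrightarrow> y \<le> int b \<or> int b + int L < y"
  shows "fillable (window_offsets m L) {}"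
proof -
  have part: "partition_on (rectangle m n) P"
    and tile: "\<And>t. t \<in> P \<Longrightarrow> is_T_tetromino t \<or> is_monomino t"
    using tiling by (auto simp: is_tiling_def)
  have strip: "t \<subseteq> {0..<int m} \<times> UNIV" if "t \<in> P" for t
    using partition_onD1[OF part] that by (auto simp: rectangle_def)
  have "has_offered_part m L (trace m (int b) t)" if "t \<in> P" for t
    using tile[OF that] strip[OF that] no_mono that by (intro has_offered_part_trace) auto
  then obtain f where f: "f t \<subseteq> trace m (int b) t" "trace m (int b) t - {..<m} \<subseteq> f t"
      "f t = {} \<or> offered (window_offsets m L) (f t)" if "t \<in> P" for t
    unfolding has_offered_part_def by metis
  show ?thesis
  proof (rule fillable_if_disjoint_offered)
    show "disjoint (f ` P - {{}})"
    proof (rule disjointI)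
      fix q r assume "q \<in> f ` P - {{}}" "r \<in> f ` P - {{}}" "q \<noteq> r"
      then obtain t u where tu: "t \<in> P" "u \<in> P" "q = f t" "r = f u" "t \<noteq> u" by blast
      then have "t \<inter> u = {}" using partition_onD2[OF part] by (auto dest: disjointD)
      then show "q \<inter> r = {}"
        using trace_disjoint[OF strip[OF tu(1)] strip[OF tu(2)], of "int b"] f(1) tu by blast
    qed
    show "offered (window_offsets m L) q" if "q \<in> f ` P - {{}}" for q
      using that f(3) by blast
    fix k assume k: "k < length (window_offsets m L)" "{0} \<notin> window_offsets m L ! k"
    have "m \<le> k"
      using k(2) nth_window_offsets[of k m 0 L] by (cases "k < m") (auto simp: entry_offsets_def)
    moreover obtain t where t: "t \<in> P" "k \<in> trace m (int b) t"
      using index_in_trace[OF tiling \<open>b + L < n\<close>] k(1) by (auto simp: length_window_offsets)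
    ultimately have "k \<in> f t" using f(2)[OF t(1)] by auto
    then show "k \<in> \<Union>(f ` P - {{}})" using t(1) by blast
  qed
qed

lemma div_le_gap_number:
  assumes "\<not> fillable (window_offsets m L) {}"
  shows "(n - 1) div L \<le> gap_number m n"
proof -
  obtain P where P: "is_tiling m n P" "num_monominos P = gap_number m n"
    using gap_number_attained by blast
  define gaps where "gaps = {t \<in> P. is_monomino t}"
  define window :: "cell set \<Rightarrow> nat" where "window t = nat (snd (the_elem t) - 1) div L" for t
  have "{..<(n - 1) div L} \<subseteq> window ` gaps"
  proof
    fix j assume j: "j \<in> {..<(n - 1) div L}"
    then have "Suc j * L \<le> (n - 1) div L * L" by (intro mult_le_mono1) simp
    also have "\<dots> \<le> n - 1" by (rule div_times_less_eq_dividend)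
    finally have "Suc j * L \<le> n - 1" .
    moreover have "0 < n" using j by (auto intro: gr0I)
    ultimately have "L * j + L < n" by (simp add: algebra_simps)
    then obtain x y where xy: "{(x, y)} \<in> P" "int (L * j) < y" "y \<le> int (L * j) + int L"
      using fillable_window_offsets[OF P(1), of "L * j" L] assms by force
    then obtain v where v: "y = int v" "L * j < v" "v \<le> L * j + L"
      by (cases y rule: int_cases) (auto simp flip: of_nat_mult of_nat_add)
    then have "window {(x, y)} = j"
      unfolding window_def by (intro div_nat_eqI) (auto simp: nat_diff_distrib)
    moreover have "{(x, y)} \<in> gaps" using xy(1) by (simp add: gaps_def is_monomino_def)
    ultimately show "j \<in> window ` gaps" by blast
  qed
  then have "(n - 1) div L \<le> card gaps"
    using is_tiling_finite[OF P(1)] surj_card_le[of gaps "{..<(n - 1) div L}" window]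
    by (simp add: gaps_def)
  then show ?thesis using P(2) by (simp add: gaps_def num_monominos_def)
qed

section \<open>The search in width 9\<close>

text \<open>Offsets are at most 18, so that 18 bits describe the covered cells.\<close>

definition support :: "bool list \<Rightarrow> nat set" where
  "support bs = {i. i < length bs \<and> bs ! i}"

lemma zero_in_support: "0 \<in> support (b # bs) \<longleftrightarrow> b"
  by (simp add: support_def)

lemma Suc_in_support: "Suc i \<in> support (b # bs) \<longleftrightarrow> i \<in> support bs"
  by (simp add: support_def)

lemma support_replicate_False: "support (replicate n False) = {}"
  by (simp add: support_def)

lemma support_snoc_False: "support (bs @ [False]) = support bs"
  by (auto simp: support_def nth_append less_Suc_eq)

lemma support_list_update: "i < length bs \<Longrightarrow> support (bs[i := True]) = insert i (support bs)"
  by (auto simp: support_def nth_list_update)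

abbreviation set_bits :: "nat list \<Rightarrow> bool list \<Rightarrow> bool list" where
  "set_bits \<equiv> fold (\<lambda>i bs. bs[i := True])"

lemma support_set_bits:
  "\<forall>i\<in>set is. i < length bs \<Longrightarrow> support (set_bits is bs) = set is \<union> support bs"
  by (induction "is" arbitrary: bs) (auto simp: support_list_update)

lemma fillable_support_True:
  "fillable (Ds # Dss) (support (True # bs)) \<longleftrightarrow> fillable Dss (support (bs @ [False]))"
  by (simp add: support_snoc_False zero_in_support vimage_def Suc_in_support)

lemma fillable_empty_support_False: "\<not> fillable ({} # Dss) (support (False # bs))"
  by (simp add: zero_in_support)

lemma fillable_insert_support_False:
  assumes "\<forall>i\<in>set is. i \<le> length bs"
  shows "fillable (insert (insert 0 (set (map Suc is))) Ds # Dss) (support (False # bs)) \<longleftrightarrow>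
     (\<forall>i\<in>set is. \<not> (bs @ [False]) ! i) \<and>
       fillable Dss (support (set_bits is (bs @ [False]))) \<or>
     fillable (Ds # Dss) (support (False # bs))"
proof -
  define D where "D = insert 0 (Suc ` set is)"
  have "Suc -` (D \<union> support (False # bs)) = support (set_bits is (bs @ [False]))"
    using assms by (subst support_set_bits)
      (auto simp: D_def support_snoc_False less_Suc_eq_le Suc_in_support)
  moreover have "D \<inter> support (False # bs) = {} \<longleftrightarrow> (\<forall>i\<in>set is. \<not> (bs @ [False]) ! i)"
    using assms by (auto simp: D_def support_def nth_append disjoint_iff)
  ultimately show ?thesis by (simp add: zero_in_support flip: D_def)
qed

declare fillable.simps(2) [simp del]

text \<open>The index lists below are the nonzero offsets of the pieces, less one.\<close>

lemmas fillable_insert_18_bits = fillable_insert_support_False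
    [of _ "[a1, a2, a3, a4, a5, a6, a7, a8, a9, a10, a11, a12, a13, a14, a15, a16, a17]"]
  for a1 a2 a3 a4 a5 a6 a7 a8 a9 a10 a11 a12 a13 a14 a15 a16 a17

lemmas fillable_18_bits =
  fillable_support_True
    [of _ _ "[a1, a2, a3, a4, a5, a6, a7, a8, a9, a10, a11, a12, a13, a14, a15, a16, a17]", simplified]
  fillable_empty_support_False
  fillable_insert_18_bits[of "[8, 9, 17]", simplified]
  fillable_insert_18_bits[of "[7, 8, 17]", simplified]
  fillable_insert_18_bits[of "[0, 1, 9]", simplified, folded numeral_2_eq_2 One_nat_def]
  fillable_insert_18_bits[of "[7, 8, 9]", simplified]
  fillable_insert_18_bits[of "[]", simplified]
  fillable_insert_18_bits[of "[0, 8]", simplified, folded One_nat_def]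
  fillable_insert_18_bits[of "[0, 9]", simplified, folded One_nat_def]
  for a1 a2 a3 a4 a5 a6 a7 a8 a9 a10 a11 a12 a13 a14 a15 a16 a17

lemma fillable_T_column_9:
  "fillable (concat (replicate (Suc n) (map (T_offsets 9) [0..<9]))) S =
   fillable
      ({{0, 9, 10, 18}, {0, 1, 2, 10}} #
       {{0, 9, 10, 18}, {0, 8, 9, 18}, {0, 1, 2, 10}, {0, 8, 9, 10}} #
       {{0, 9, 10, 18}, {0, 8, 9, 18}, {0, 1, 2, 10}, {0, 8, 9, 10}} #
       {{0, 9, 10, 18}, {0, 8, 9, 18}, {0, 1, 2, 10}, {0, 8, 9, 10}} #
       {{0, 9, 10, 18}, {0, 8, 9, 18}, {0, 1, 2, 10}, {0, 8, 9, 10}} #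
       {{0, 9, 10, 18}, {0, 8, 9, 18}, {0, 1, 2, 10}, {0, 8, 9, 10}} #
       {{0, 9, 10, 18}, {0, 8, 9, 18}, {0, 1, 2, 10}, {0, 8, 9, 10}} #
       {{0, 9, 10, 18}, {0, 8, 9, 18}, {0, 8, 9, 10}} #
       {{0, 8, 9, 18}} #
       concat (replicate n (map (T_offsets 9) [0..<9]))) S"
  by (simp add: T_offsets_def upt_conv_Cons del: Un_insert_right)

lemma fillable_entry_column_9:
  "fillable (map (entry_offsets 9) [0..<9] @ Dss) S =
   fillable
      ({{0}, {0, 1, 9}, {0, 1, 10}, {0, 9, 10, 18}} #
       {{0}, {0, 1, 9}, {0, 1, 10}, {0, 9, 10, 18}, {0, 8, 9, 18}, {0, 8, 9, 10}} #
       {{0}, {0, 1, 9}, {0, 1, 10}, {0, 9, 10, 18}, {0, 8, 9, 18}, {0, 8, 9, 10}} #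
       {{0}, {0, 1, 9}, {0, 1, 10}, {0, 9, 10, 18}, {0, 8, 9, 18}, {0, 8, 9, 10}} #
       {{0}, {0, 1, 9}, {0, 1, 10}, {0, 9, 10, 18}, {0, 8, 9, 18}, {0, 8, 9, 10}} #
       {{0}, {0, 1, 9}, {0, 1, 10}, {0, 9, 10, 18}, {0, 8, 9, 18}, {0, 8, 9, 10}} #
       {{0}, {0, 1, 9}, {0, 1, 10}, {0, 9, 10, 18}, {0, 8, 9, 18}, {0, 8, 9, 10}} #
       {{0}, {0, 1, 9}, {0, 1, 10}, {0, 9, 10, 18}, {0, 8, 9, 18}, {0, 8, 9, 10}} #
       {{0}, {0, 8, 9, 18}} #
       Dss) S"
  by (simp add: entry_offsets_def upt_conv_Cons del: Un_insert_right)

text \<open>As a congruence rule, this keeps the simplifier out of the bit vectors and of the rest of the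
  window, which are in normal form; the search visits some 900000 cells.\<close>

lemma fillable_refl_cong: "fillable Dss S \<longleftrightarrow> fillable Dss S"
  by (rule refl)

lemma not_fillable_window_9_17: "\<not> fillable (window_offsets 9 17) {}"
proof -
  have empty: "{} = support [False, False, False, False, False, False, False, False, False,
      False, False, False, False, False, False, False, False, False]"
    using support_replicate_False[of 18] by (simp add: numeral_eq_Suc)
  have seventeen: "17 = Suc (Suc (Suc (Suc (Suc (Suc (Suc (Suc (Suc (Suc (Suc (Suc (Suc (Suc
      (Suc (Suc (Suc 0))))))))))))))))"
    by simp
  show ?thesis
    unfolding window_offsets_def empty seventeen
    by (simp only: fillable_18_bits fillable_entry_column_9 fillable_T_column_9 simp_thms
        cong: fillable_refl_cong conj_left_cong)
qed

lemma gap_number_9_ge: "(n - 1) div 17 \<le> gap_number 9 n"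
  using not_fillable_window_9_17 by (rule div_le_gap_number)

theorem theorem2:
  "\<exists>e\<^sub>9 :: nat \<Rightarrow> int.
     (\<exists>B. \<forall>n\<ge>1. \<bar>e\<^sub>9 n\<bar> \<le> B) \<and>
     (\<forall>n\<ge>1. int (gap_number 9 n) = \<lfloor>real n / 17\<rfloor> + e\<^sub>9 n)"
proof (intro exI conjI allI impI)
  fix n :: nat
  have "\<lfloor>real n / 17\<rfloor> = int (n div 17)"
    using floor_divide_of_nat_eq[of n 17] by simp
  then show "int (gap_number 9 n) = \<lfloor>real n / 17\<rfloor> + (int (gap_number 9 n) - int (n div 17))"
    by simp
  have "n div 17 \<le> gap_number 9 n + 1"
    using gap_number_9_ge[of n] by linarith
  with gap_number_9_le[of n] show "\<bar>int (gap_number 9 n) - int (n div 17)\<bar> \<le> 162"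
    by linarith
qed

end
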